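(* Consider any non-degenerate recursive rational forecasting system $\varphi_r$. Then any path $\omega\in\{0,1\}^{\mathbb{N}}$ is Martin-Löf random for $\varphi_r$ if and only if the prequential path $(\varphi_r[\omega],\omega)\in(\mathcal{I}_r\times\{0,1\})^{\mathbb{N}}$ is game-random.
   Context: Let $\mathcal{X}=\{0,1\}$, $\mathbb{N}=\{1,2,\dots\}$ and $\mathbb{N}_0=\mathbb{N}\cup\{0\}$. An interval forecast is a non-empty closed interval $I\subseteq[0,1]$ (possibly a single point); $\mathcal{I}_r$ is the set of all interval forecasts with rational endpoints. For an interval forecast $I$ and $f\colon\mathcal{X}\to\mathbb{R}$, the upper expectation is $\overline{E}_I(f)=\max_{p\in I}[pf(1)+(1-p)f(0)]$. Situations are the elements $w$ of $\mathcal{X}^*=\bigcup_{k\in\mathbb{N}_0}\mathcal{X}^k$; $\square$ is the empty situation and $wx$ is the concatenation of $w$ with $x\in\mathcal{X}$. A path is an element $\omega=(\omega_1,\omega_2,\dots)\in\mathcal{X}^{\mathbb{N}}$, with prefixes $\omega_{1:n}$ of length $n$. Prequential situations are the elements $v=(I_1,x_1,\dots,I_n,x_n)$ of $(\mathcal{I}_r\times\mathcal{X})^*=\bigcup_{k\in\mathbb{N}_0}(\mathcal{I}_r\times\mathcal{X})^k$, with the empty one also denoted $\square$; $vI_rx$ is the concatenation of $v$ with $I_r\in\mathcal{I}_r$ and $x\in\mathcal{X}$. A prequential path is $\upsilon=(I_1,x_1,I_2,x_2,\dots)\in(\mathcal{I}_r\times\mathcal{X})^{\mathbb{N}}$, identified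 with the pair $(\iota,\omega)$ where $\iota=(I_1,I_2,\dots)$ and $\omega=(x_1,x_2,\dots)$; $\upsilon_{1:n}=(I_1,x_1,\dots,I_n,x_n)$. It is non-degenerate if $\iota_n\neq\{1-\omega_n\}$ for all $n\in\mathbb{N}$. A rational forecasting system is a map $\varphi_r\colon\mathcal{X}^*\to\mathcal{I}_r$; it is non-degenerate if $\min\varphi_r(w)<1$ and $\max\varphi_r(w)>0$ for all $w\in\mathcal{X}^*$, and recursive if $w\mapsto\min\varphi_r(w)$ and $w\mapsto\max\varphi_r(w)$ are recursive (Turing-computable, via encodings) rational maps. For a path $\omega$, $\varphi_r[\omega]=(\varphi_r(\omega_{1:0}),\varphi_r(\omega_{1:1}),\varphi_r(\omega_{1:2}),\dots)$. A map $r\colon\mathcal{D}\to\mathbb{R}$ on a countable encoded set $\mathcal{D}$ is lower semicomputable if there is a recursive map $q\colon\mathcal{D}\times\mathbb{N}_0\to\mathbb{Q}$ with $q(d,n)\leq q(d,n+1)$ and $\lim_{m\to\infty}q(d,m)=r(d)$ for all $d,n$. A test supermartingale for $\varphi_r$ is a map $T\colon\mathcal{X}^*\to\mathbb{R}$ with $T\geq0$, $T(\square)=1$ and $\overline{E}_{\varphi_r(w)}(T(w\,\cdot))\leq T(w)$ for all $w\in\mathcal{X}^*$, where $T(w\,\cdot)$ is the map $x\mapsto T(wx)$. A path $\omega$ is Martin-Löf random for $\varphi_r$ if $\limsup_{n\to\infty}T(\omega_{1:n})<\infty$ for all lower semicomputable test supermartingales $T$ for $\varphi_r$. A test superfarthingale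 is a map $F\colon(\mathcal{I}_r\times\mathcal{X})^*\to\mathbb{R}$ with $F\geq0$, $F(\square)=1$ and $\overline{E}_{I_r}(F(vI_r\,\cdot))\leq F(v)$ for all prequential situations $v$ and all $I_r\in\mathcal{I}_r$, where $F(vI_r\,\cdot)$ is the map $x\mapsto F(vI_rx)$. A prequential path $\upsilon$ is game-random if it is non-degenerate and all lower semicomputable test superfarthingales $F$ satisfy $\limsup_{n\to\infty}F(\upsilon_{1:n})<\infty$. *)

theory Defs
  imports Complex_Main "HOL-Library.Nat_Bijection" "HOL-Library.Extended_Real"
begin

section \<open>Recursive maps\<close>

text \<open>
  Recursive means \<open>\<mu>\<close>-recursive. Programs carry no arity: \<open>evaluates e xs y\<close> says that \<open>e\<close>,
  run on the argument tuple \<open>xs\<close>, halts with value \<open>y\<close>. For \<open>PrimRec\<close> the recursion variable,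
  and for \<open>Mu\<close> the search variable, is the first argument.
\<close>

datatype recf =
    Zero
  | Succ
  | Proj nat
  | Comp recf "recf list"
  | PrimRec recf recf
  | Mu recf

inductive evaluates :: "recf \<Rightarrow> nat list \<Rightarrow> nat \<Rightarrow> bool" where
  Zero: "evaluates Zero xs 0"
| Succ: "evaluates Succ [x] (Suc x)"
| Proj: "i < length xs \<Longrightarrow> evaluates (Proj i) xs (xs ! i)"
| Comp: "list_all2 (\<lambda>g y. evaluates g xs y) gs ys \<Longrightarrow> evaluates f ys z
    \<Longrightarrow> evaluates (Comp f gs) xs z"
| PrimRec_0: "evaluates f xs y \<Longrightarrow> evaluates (PrimRec f g) (0 # xs) y"
| PrimRec_Suc: "evaluates (PrimRec f g) (n # xs) y \<Longrightarrow> evaluates g (n # y # xs) z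
    \<Longrightarrow> evaluates (PrimRec f g) (Suc n # xs) z"
| Mu: "evaluates f (n # xs) 0 \<Longrightarrow> (\<And>i. i < n \<Longrightarrow> \<exists>y. evaluates f (i # xs) (Suc y))
    \<Longrightarrow> evaluates (Mu f) xs n"

lemma evaluates_deterministic:
  "evaluates e xs y \<Longrightarrow> evaluates e xs z \<Longrightarrow> y = z"
proof (induction arbitrary: z rule: evaluates.induct)
  case (Zero xs)
  then show ?case by cases simp
next
  case (Succ x)
  then show ?case by cases simp
next
  case (Proj i xs)
  from Proj.prems show ?case by cases simp
next
  case (Comp xs gs ys f y)
  from Comp.prems obtain ys' where ys': "list_all2 (\<lambda>g y. evaluates g xs y) gs ys'" "evaluates f ys' z"
    by cases
  have "ys = ys'"
    using Comp.IH(1) ys'(1) by (auto simp: list_all2_conv_all_nth intro!: nth_equalityI)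
  then show ?case using Comp.IH(2) ys'(2) by simp
next
  case (PrimRec_0 f xs y g)
  from PrimRec_0.prems show ?case by cases (auto dest: PrimRec_0.IH)
next
  case (PrimRec_Suc f g n xs y y')
  from PrimRec_Suc.prems show ?case
    by cases (use PrimRec_Suc.IH in blast)
next
  case (Mu f n xs)
  from Mu.prems show ?case
  proof cases
    case Mu': Mu
    have "\<not> n < z" using Mu'(2) Mu.IH(1) by fastforce
    moreover have "\<not> z < n" using Mu'(1) Mu.IH(2) by fastforce
    ultimately show ?thesis by simp
  qed
qed

definition recursive_nat :: "(nat \<Rightarrow> nat) \<Rightarrow> bool" where
  "recursive_nat g \<longleftrightarrow> (\<exists>e. \<forall>n. evaluates e [n] (g n))"

text \<open>
  The encodings must be concrete and effective; \<open>to_nat\<close> of class \<open>countable\<close> is an unspecified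
  choice and would not do.
\<close>

definition recursive_map :: "('a \<Rightarrow> nat) \<Rightarrow> ('b \<Rightarrow> nat) \<Rightarrow> ('a \<Rightarrow> 'b) \<Rightarrow> bool" where
  "recursive_map enc\<^sub>1 enc\<^sub>2 f \<longleftrightarrow> (\<exists>g. recursive_nat g \<and> (\<forall>d. g (enc\<^sub>1 d) = enc\<^sub>2 (f d)))"

definition rat_code :: "rat \<Rightarrow> nat" where
  "rat_code r = prod_encode (map_prod int_encode int_encode (quotient_of r))"

definition lower_semicomputable :: "('d \<Rightarrow> nat) \<Rightarrow> ('d \<Rightarrow> real) \<Rightarrow> bool" where
  "lower_semicomputable enc r \<longleftrightarrow>
    (\<exists>q :: 'd \<times> nat \<Rightarrow> rat.
      recursive_map (\<lambda>(d, n). prod_encode (enc d, n)) rat_code q \<and>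
      (\<forall>d n. q (d, n) \<le> q (d, Suc n)) \<and>
      (\<forall>d. (\<lambda>m. real_of_rat (q (d, m))) \<longlonglongrightarrow> r d))"

section \<open>Interval forecasts\<close>

text \<open>Outcomes are booleans: \<open>False\<close> is 0 and \<open>True\<close> is 1.\<close>

definition upper_expectation :: "real set \<Rightarrow> (bool \<Rightarrow> real) \<Rightarrow> real" where
  "upper_expectation I f = (SUP p\<in>I. p * f True + (1 - p) * f False)"

text \<open>A forecast with rational endpoints is represented by its pair of endpoints.\<close>

typedef rat_forecast = "{(a :: rat, b :: rat). 0 \<le> a \<and> a \<le> b \<and> b \<le> 1}"
  by (rule exI[of _ "(0, 1)"]) simp

definition lo :: "rat_forecast \<Rightarrow> rat" where
  "lo I = fst (Rep_rat_forecast I)"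

definition hi :: "rat_forecast \<Rightarrow> rat" where
  "hi I = snd (Rep_rat_forecast I)"

definition forecast_set :: "rat_forecast \<Rightarrow> real set" where
  "forecast_set I = {real_of_rat (lo I)..real_of_rat (hi I)}"

lemma lo_hi: "0 \<le> lo I" "lo I \<le> hi I" "hi I \<le> 1"
  using Rep_rat_forecast[of I] by (auto simp: lo_def hi_def)

lemma upper_expectation_is_max:
  "\<exists>p\<in>forecast_set I. upper_expectation (forecast_set I) f = p * f True + (1 - p) * f False \<and>
    (\<forall>q\<in>forecast_set I. q * f True + (1 - q) * f False \<le> p * f True + (1 - p) * f False)"
proof -
  let ?h = "\<lambda>p. p * f True + (1 - p) * f False"
  define p where "p = real_of_rat (if f False \<le> f True then hi I else lo I)"
  have p: "p \<in> forecast_set I"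
    using lo_hi(2)[of I] by (auto simp: p_def forecast_set_def of_rat_less_eq)
  have "?h p - ?h q = (p - q) * (f True - f False)" for q
    by (simp add: algebra_simps)
  moreover have "(p - q) * (f True - f False) \<ge> 0" if "q \<in> forecast_set I" for q
    using that by (auto simp: p_def forecast_set_def zero_le_mult_iff)
  ultimately have max: "?h q \<le> ?h p" if "q \<in> forecast_set I" for q
    using that by (metis diff_ge_0_iff_ge)
  moreover have "upper_expectation (forecast_set I) f = ?h p"
    unfolding upper_expectation_def using p max by (intro cSup_eq_maximum) auto
  ultimately show ?thesis using p by blast
qed

section \<open>Situations, paths and their encodings\<close>

text \<open>
  Sequences are indexed from 0, so the \<open>n\<close>-th entry of a path, for \<open>n \<ge> 1\<close>, is its value at
  \<open>n - 1\<close>. The same \<open>initial\<close> serves paths and prequential paths.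
\<close>

type_synonym situation = "bool list"
type_synonym path = "nat \<Rightarrow> bool"
type_synonym prequential_situation = "(rat_forecast \<times> bool) list"
type_synonym prequential_path = "nat \<Rightarrow> rat_forecast \<times> bool"
type_synonym forecasting_system = "situation \<Rightarrow> rat_forecast"

definition initial :: "(nat \<Rightarrow> 'a) \<Rightarrow> nat \<Rightarrow> 'a list" where
  "initial s n = map s [0..<n]"

definition situation_code :: "situation \<Rightarrow> nat" where
  "situation_code w = list_encode (map of_bool w)"

definition forecast_code :: "rat_forecast \<Rightarrow> nat" where
  "forecast_code I = prod_encode (rat_code (lo I), rat_code (hi I))"

definition prequential_code :: "prequential_situation \<Rightarrow> nat" where
  "prequential_code v = list_encode (map (\<lambda>(I, x). prod_encode (forecast_code I, of_bool x)) v)"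

section \<open>Randomness\<close>

definition nondegenerate_system :: "forecasting_system \<Rightarrow> bool" where
  "nondegenerate_system \<phi> \<longleftrightarrow> (\<forall>w. lo (\<phi> w) < 1 \<and> hi (\<phi> w) > 0)"

definition recursive_system :: "forecasting_system \<Rightarrow> bool" where
  "recursive_system \<phi> \<longleftrightarrow>
    recursive_map situation_code rat_code (\<lambda>w. lo (\<phi> w)) \<and>
    recursive_map situation_code rat_code (\<lambda>w. hi (\<phi> w))"

definition forecasts_along :: "forecasting_system \<Rightarrow> path \<Rightarrow> nat \<Rightarrow> rat_forecast" where
  "forecasts_along \<phi> \<omega> n = \<phi> (initial \<omega> n)"

definition test_supermartingale :: "forecasting_system \<Rightarrow> (situation \<Rightarrow> real) \<Rightarrow> bool" where
  "test_supermartingale \<phi> T \<longleftrightarrow>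
    (\<forall>w. 0 \<le> T w) \<and> T [] = 1 \<and>
    (\<forall>w. upper_expectation (forecast_set (\<phi> w)) (\<lambda>x. T (w @ [x])) \<le> T w)"

definition martin_loef_random :: "forecasting_system \<Rightarrow> path \<Rightarrow> bool" where
  "martin_loef_random \<phi> \<omega> \<longleftrightarrow>
    (\<forall>T. test_supermartingale \<phi> T \<and> lower_semicomputable situation_code T \<longrightarrow>
      limsup (\<lambda>n. ereal (T (initial \<omega> n))) < \<infinity>)"

definition test_superfarthingale :: "(prequential_situation \<Rightarrow> real) \<Rightarrow> bool" where
  "test_superfarthingale F \<longleftrightarrow>
    (\<forall>v. 0 \<le> F v) \<and> F [] = 1 \<and>
    (\<forall>v I. upper_expectation (forecast_set I) (\<lambda>x. F (v @ [(I, x)])) \<le> F v)"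

definition nondegenerate_path :: "prequential_path \<Rightarrow> bool" where
  "nondegenerate_path \<upsilon> \<longleftrightarrow>
    (\<forall>n. forecast_set (fst (\<upsilon> n)) \<noteq> {1 - of_bool (snd (\<upsilon> n))})"

definition game_random :: "prequential_path \<Rightarrow> bool" where
  "game_random \<upsilon> \<longleftrightarrow>
    nondegenerate_path \<upsilon> \<and>
    (\<forall>F. test_superfarthingale F \<and> lower_semicomputable prequential_code F \<longrightarrow>
      limsup (\<lambda>n. ereal (F (initial \<upsilon> n))) < \<infinity>)"

end

theory Submission
  imports Defs
begin

text \<open>
  A superfarthingale restricts to a supermartingale along the forecasts of \<open>\<phi>\<close>; conversely a
  supermartingale extends to a superfarthingale by the value 0 on every prequential situation in
  which some forecast differs from the one of \<open>\<phi>\<close>. Both constructions preserve lower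
  semicomputability, because \<open>\<phi>\<close> is recursive and equality of rational forecasts is decidable.
  Non-degeneracy of \<open>\<phi>\<close> only serves to make the prequential path non-degenerate.
\<close>

section \<open>Closure properties of recursive functions\<close>

lemma evaluates_Proj: "i < length xs \<Longrightarrow> y = xs ! i \<Longrightarrow> evaluates (Proj i) xs y"
  using evaluates.Proj by simp

lemma evaluates_Comp1:
  "evaluates g xs y \<Longrightarrow> evaluates f [y] z \<Longrightarrow> evaluates (Comp f [g]) xs z"
  by (rule evaluates.Comp[where ys = "[y]"]) auto

lemma evaluates_Comp2:
  "evaluates g xs y \<Longrightarrow> evaluates h xs z \<Longrightarrow> evaluates f [y, z] u \<Longrightarrow> evaluates (Comp f [g, h]) xs u"
  by (rule evaluates.Comp[where ys = "[y, z]"]) auto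

text \<open>Two-argument programs, not unary ones on coded pairs: \<open>prod_encode\<close> is
  shown recursive only below, and its proof needs binary addition.\<close>

definition recursive_nat2 :: "(nat \<Rightarrow> nat \<Rightarrow> nat) \<Rightarrow> bool" where
  "recursive_nat2 g \<longleftrightarrow> (\<exists>e. \<forall>m n. evaluates e [m, n] (g m n))"

lemma recursive_nat2_fst: "recursive_nat2 (\<lambda>m n. m)"
  unfolding recursive_nat2_def by (rule exI[of _ "Proj 0"]) (auto intro: evaluates_Proj)

lemma recursive_nat2_snd: "recursive_nat2 (\<lambda>m n. n)"
  unfolding recursive_nat2_def by (rule exI[of _ "Proj 1"]) (auto intro: evaluates_Proj)

lemma recursive_nat2_comp1:
  assumes "recursive_nat f" "recursive_nat2 g"
  shows "recursive_nat2 (\<lambda>m n. f (g m n))"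
  using assms evaluates_Comp1 unfolding recursive_nat_def recursive_nat2_def by meson

lemma recursive_nat2_comp2:
  assumes "recursive_nat2 f" "recursive_nat2 g" "recursive_nat2 h"
  shows "recursive_nat2 (\<lambda>m n. f (g m n) (h m n))"
  using assms evaluates_Comp2 unfolding recursive_nat2_def by meson

lemma recursive_nat_id: "recursive_nat (\<lambda>n. n)"
  unfolding recursive_nat_def by (rule exI[of _ "Proj 0"]) (auto intro: evaluates_Proj)

lemma recursive_nat_comp:
  assumes "recursive_nat f" "recursive_nat g"
  shows "recursive_nat (\<lambda>n. f (g n))"
  using assms evaluates_Comp1 unfolding recursive_nat_def by meson

lemma recursive_nat_comp2:
  assumes "recursive_nat2 f" "recursive_nat g" "recursive_nat h"
  shows "recursive_nat (\<lambda>n. f (g n) (h n))"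
  using assms evaluates_Comp2 unfolding recursive_nat_def recursive_nat2_def by meson

lemma recursive_nat_Suc: "recursive_nat Suc"
  unfolding recursive_nat_def using evaluates.Succ by blast

lemma recursive_nat_const: "recursive_nat (\<lambda>n. c)"
proof (induction c)
  case 0
  show ?case unfolding recursive_nat_def using evaluates.Zero by blast
next
  case (Suc c)
  show ?case using recursive_nat_comp[OF recursive_nat_Suc Suc] .
qed

text \<open>Primitive recursion whose step sees only the previous value, picked by
  \<open>Proj 1\<close>. Later loops, such as the one in \<open>recursive_nat_foldl\<close>, are
  iterates on a coded state.\<close>

lemma recursive_nat2_funpow:
  assumes "recursive_nat f"
  shows "recursive_nat2 (\<lambda>m n. (f ^^ m) n)"
proof -
  from assms obtain e where e: "evaluates e [n] (f n)" for n
    unfolding recursive_nat_def by blast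
  have "evaluates (PrimRec (Proj 0) (Comp e [Proj 1])) [m, n] ((f ^^ m) n)" for m n
  proof (induction m)
    case 0
    show ?case by (simp add: evaluates.PrimRec_0 evaluates_Proj)
  next
    case (Suc m)
    have "evaluates (Comp e [Proj 1]) [m, (f ^^ m) n, n] ((f ^^ Suc m) n)"
      using e evaluates_Comp1[OF evaluates_Proj[OF _ refl]] by simp
    with Suc show ?case by (rule evaluates.PrimRec_Suc)
  qed
  then show ?thesis unfolding recursive_nat2_def by blast
qed

lemma recursive_nat_funpow:
  assumes "recursive_nat f" "recursive_nat m" "recursive_nat a"
  shows "recursive_nat (\<lambda>n. (f ^^ m n) (a n))"
  using recursive_nat_comp2[OF recursive_nat2_funpow] assms .

section \<open>Arithmetic, Cantor pairing and case distinction\<close>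

lemma recursive_nat2_add: "recursive_nat2 (+)"
proof -
  have "(Suc ^^ m) n = m + n" for m n by (induction m) auto
  then show ?thesis using recursive_nat2_funpow[OF recursive_nat_Suc] by simp
qed

lemma recursive_nat_diff_1: "recursive_nat (\<lambda>n. n - 1)"
proof -
  have "evaluates (PrimRec Zero (Proj 0)) [n] (n - 1)" for n
  proof (induction n)
    case 0
    show ?case by (auto intro: evaluates.PrimRec_0 evaluates.Zero)
  next
    case (Suc n)
    have "evaluates (Proj 0) [n, n - 1] (Suc n - 1)" by (simp add: evaluates_Proj)
    with Suc show ?case by (rule evaluates.PrimRec_Suc)
  qed
  then show ?thesis unfolding recursive_nat_def by blast
qed

lemma recursive_nat2_diff: "recursive_nat2 (-)"
proof -
  have "((\<lambda>k. k - 1) ^^ m) n = n - m" for m n :: nat by (induction m) auto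
  \<comment> \<open>The iteration count is the first argument, so the operands come out swapped; the
    projections exchange them again.\<close>
  then have "recursive_nat2 (\<lambda>m n. n - m)"
    using recursive_nat2_funpow[OF recursive_nat_diff_1] by simp
  from recursive_nat2_comp2[OF this recursive_nat2_snd recursive_nat2_fst] show ?thesis .
qed

lemma recursive_nat_triangle: "recursive_nat triangle"
proof -
  from recursive_nat2_comp2[OF recursive_nat2_add
      recursive_nat2_comp1[OF recursive_nat_Suc recursive_nat2_fst] recursive_nat2_snd]
  obtain e where e: "evaluates e [m, n] (Suc m + n)" for m n
    unfolding recursive_nat2_def by blast
  \<comment> \<open>Without parameters the step program receives just \<open>n\<close> and
    \<open>triangle n\<close>, and \<open>triangle (Suc n)\<close> is their sum plus 1.\<close>
  have "evaluates (PrimRec Zero e) [n] (triangle n)" for n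
  proof (induction n)
    case 0
    show ?case by (auto intro: evaluates.PrimRec_0 evaluates.Zero)
  next
    case (Suc n)
    from evaluates.PrimRec_Suc[OF this e] show ?case by (simp add: add.commute)
  qed
  then show ?thesis unfolding recursive_nat_def by blast
qed

lemma recursive_nat2_prod_encode: "recursive_nat2 (\<lambda>m n. prod_encode (m, n))"
  unfolding prod_encode_def prod.case
  by (intro recursive_nat2_comp2[OF recursive_nat2_add]
      recursive_nat2_comp1[OF recursive_nat_triangle] recursive_nat2_fst recursive_nat2_snd)

lemma triangle_mono: "m \<le> n \<Longrightarrow> triangle m \<le> triangle n"
  unfolding triangle_def by (intro div_le_mono mult_le_mono) auto

lemma triangle_prod_decode:
  assumes "prod_decode n = (a, b)"
  shows "triangle (a + b) + a = n"
proof -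
  have "prod_encode (a, b) = n" unfolding assms[symmetric] by simp
  then show ?thesis by (simp add: prod_encode_def)
qed

text \<open>
  The sum of the two components of \<open>prod_decode n\<close> is the least \<open>k\<close> with \<open>n < triangle (Suc k)\<close>.
\<close>

lemma recursive_nat_prod_decode_sum:
  "recursive_nat (\<lambda>n. fst (prod_decode n) + snd (prod_decode n))"
proof -
  \<comment> \<open>Subtraction truncates, so \<open>Suc n - triangle (Suc k)\<close> is 0 exactly
    if \<open>n < triangle (Suc k)\<close>; for smaller \<open>k\<close> it is positive, as
    \<open>Mu\<close> requires.\<close>
  from recursive_nat2_comp2[OF recursive_nat2_diff
      recursive_nat2_comp1[OF recursive_nat_Suc recursive_nat2_snd]
      recursive_nat2_comp1[OF recursive_nat_comp[OF recursive_nat_triangle recursive_nat_Suc] recursive_nat2_fst]]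
  obtain e where e: "evaluates e [k, n] (Suc n - triangle (Suc k))" for k n
    unfolding recursive_nat2_def by blast
  have "evaluates (Mu e) [n] (fst (prod_decode n) + snd (prod_decode n))" for n
  proof -
    obtain a b where ab: "prod_decode n = (a, b)" by fastforce
    then have n: "triangle (a + b) + a = n" by (rule triangle_prod_decode)
    then have "Suc n - triangle (Suc (a + b)) = 0" by simp
    with e[of "a + b" n] have 0: "evaluates e [a + b, n] 0" by (simp del: triangle_Suc)
    have "\<exists>y. evaluates e [i, n] (Suc y)" if "i < a + b" for i
    proof -
      have "triangle (Suc i) \<le> n" using triangle_mono[of "Suc i" "a + b"] that n by simp
      then have "Suc n - triangle (Suc i) = Suc (n - triangle (Suc i))" by (rule Suc_diff_le)
      with e[of i n] have "evaluates e [i, n] (Suc (n - triangle (Suc i)))" by simp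
      then show ?thesis by blast
    qed
    with 0 have "evaluates (Mu e) [n] (a + b)" by (rule evaluates.Mu)
    then show ?thesis by (simp add: ab)
  qed
  then show ?thesis unfolding recursive_nat_def by blast
qed

lemma recursive_nat_fst_prod_decode: "recursive_nat (\<lambda>n. fst (prod_decode n))"
proof -
  have "n - triangle (fst (prod_decode n) + snd (prod_decode n)) = fst (prod_decode n)" for n
  proof -
    obtain a b where "prod_decode n = (a, b)" by fastforce
    with triangle_prod_decode[OF this] show ?thesis by auto
  qed
  moreover have "recursive_nat (\<lambda>n. n - triangle (fst (prod_decode n) + snd (prod_decode n)))"
    by (intro recursive_nat_comp2[OF recursive_nat2_diff] recursive_nat_id
        recursive_nat_comp[OF recursive_nat_triangle] recursive_nat_prod_decode_sum)
  ultimately show ?thesis by simp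
qed

lemma recursive_nat_snd_prod_decode: "recursive_nat (\<lambda>n. snd (prod_decode n))"
  using recursive_nat_comp2[OF recursive_nat2_diff recursive_nat_prod_decode_sum recursive_nat_fst_prod_decode]
  by simp

lemmas recursive_nat_fst = recursive_nat_comp[OF recursive_nat_fst_prod_decode]
lemmas recursive_nat_snd = recursive_nat_comp[OF recursive_nat_snd_prod_decode]
lemmas recursive_nat_pair = recursive_nat_comp2[OF recursive_nat2_prod_encode]

text \<open>Branching by iteration: \<open>?s\<close> overwrites the first component of a pair with
  the second. No step leaves \<open>a n\<close> in front, one or more leave \<open>b n\<close>, and
  the step count \<open>?d n\<close> is 0 exactly if \<open>f n = g n\<close>.\<close>

lemma recursive_nat_if_eq:
  assumes "recursive_nat f" "recursive_nat g" "recursive_nat a" "recursive_nat b"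
  shows "recursive_nat (\<lambda>n. if f n = g n then a n else b n)"
proof -
  let ?s = "\<lambda>p. prod_encode (snd (prod_decode p), snd (prod_decode p))"
  let ?d = "\<lambda>n. (f n - g n) + (g n - f n)"
  have iter: "(?s ^^ k) (prod_encode (x, y)) = (if k = 0 then prod_encode (x, y) else prod_encode (y, y))"
    for k x y
    by (induction k) auto
  have "recursive_nat (\<lambda>n. fst (prod_decode ((?s ^^ ?d n) (prod_encode (a n, b n)))))"
    by (intro recursive_nat_fst recursive_nat_funpow recursive_nat_pair recursive_nat_snd
        recursive_nat_id recursive_nat_comp2[OF recursive_nat2_add]
        recursive_nat_comp2[OF recursive_nat2_diff] assms)
  moreover have "fst (prod_decode ((?s ^^ ?d n) (prod_encode (a n, b n)))) = (if f n = g n then a n else b n)" for n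
    unfolding iter by auto
  ultimately show ?thesis by simp
qed

section \<open>Recursion on coded lists\<close>

text \<open>Lets the code of a list serve as a step count large enough to consume the list.\<close>

lemma length_le_list_encode: "length xs \<le> list_encode xs"
proof (induction xs)
  case (Cons x xs)
  then show ?case using le_prod_encode_2[of "list_encode xs" x] by simp
qed simp

lemma recursive_nat_Cons:
  assumes "recursive_nat f" "recursive_nat g"
  shows "recursive_nat (\<lambda>n. list_encode (f n # list_decode (g n)))"
  using recursive_nat_comp[OF recursive_nat_Suc recursive_nat_pair[OF assms]] by simp

text \<open>The fold becomes a loop on pairs of accumulator and code of the remaining list. Surplus
  steps are harmless: once that code is 0, the code of the empty list, \<open>s\<close> leaves the
  state alone.\<close>

lemma recursive_nat_foldl:
  assumes f: "recursive_nat (\<lambda>p. f (fst (prod_decode p)) (snd (prod_decode p)))"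
    and "recursive_nat a" "recursive_nat l"
  shows "recursive_nat (\<lambda>n. foldl f (a n) (list_decode (l n)))"
proof -
  \<comment> \<open>Subtracting 1 undoes the \<open>Suc\<close> in the code of a nonempty list,
    which leaves the pair of its head and the code of its tail.\<close>
  let ?h = "\<lambda>p. prod_decode (snd (prod_decode p) - 1)"
  define s where "s p = (if snd (prod_decode p) = 0 then p
    else prod_encode (f (fst (prod_decode p)) (fst (?h p)), snd (?h p)))" for p
  have "recursive_nat (\<lambda>p. (\<lambda>q. f (fst (prod_decode q)) (snd (prod_decode q)))
      (prod_encode (fst (prod_decode p), fst (?h p))))"
    by (rule recursive_nat_comp[OF f])
      (intro recursive_nat_pair recursive_nat_fst recursive_nat_snd recursive_nat_id
        recursive_nat_comp[OF recursive_nat_diff_1])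
  then have "recursive_nat (\<lambda>p. f (fst (prod_decode p)) (fst (?h p)))" by simp
  then have s: "recursive_nat s"
    unfolding s_def
    by (intro recursive_nat_if_eq recursive_nat_pair recursive_nat_fst recursive_nat_snd
        recursive_nat_id recursive_nat_const recursive_nat_comp[OF recursive_nat_diff_1])
  have s_Nil: "(s ^^ k) (prod_encode (x, 0)) = prod_encode (x, 0)" for k x
    by (induction k) (auto simp: s_def)
  have "(s ^^ k) (prod_encode (x, list_encode ys)) = prod_encode (foldl f x ys, 0)"
    if "length ys \<le> k" for k x ys
    using that
  proof (induction ys arbitrary: k x)
    case Nil
    show ?case by (simp add: s_Nil)
  next
    case (Cons y ys)
    then obtain k' where k': "k = Suc k'" "length ys \<le> k'" by (cases k) auto
    have "s (prod_encode (x, list_encode (y # ys))) = prod_encode (f x y, list_encode ys)"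
      by (simp add: s_def)
    then show ?case using Cons.IH[OF k'(2)] by (simp add: k'(1) funpow_Suc_right del: funpow.simps)
  qed
  from this[of "list_decode c" c for c] length_le_list_encode[of "list_decode c" for c]
  have "foldl f x (list_decode c) = fst (prod_decode ((s ^^ c) (prod_encode (x, c))))" for x c
    by simp
  moreover have "recursive_nat (\<lambda>n. fst (prod_decode ((s ^^ l n) (prod_encode (a n, l n)))))"
    by (intro recursive_nat_fst recursive_nat_funpow recursive_nat_pair s assms)
  ultimately show ?thesis by simp
qed

text \<open>A left fold that conses its results builds the mapped list backwards; a second reversal
  then gives \<open>recursive_nat_map\<close>.\<close>

lemma recursive_nat_rev_map:
  assumes "recursive_nat f" "recursive_nat l"
  shows "recursive_nat (\<lambda>n. list_encode (rev (map f (list_decode (l n)))))"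
proof -
  have "foldl (\<lambda>r y. list_encode (f y # list_decode r)) (list_encode zs) ys
      = list_encode (rev (map f ys) @ zs)" for ys zs
    by (induction ys arbitrary: zs) (simp_all del: list_encode.simps)
  from this[of "[]"]
  have "foldl (\<lambda>r y. list_encode (f y # list_decode r)) 0 ys = list_encode (rev (map f ys))" for ys
    by simp
  moreover have "recursive_nat (\<lambda>n. foldl (\<lambda>r y. list_encode (f y # list_decode r)) 0 (list_decode (l n)))"
    by (intro recursive_nat_foldl recursive_nat_Cons recursive_nat_comp[OF assms(1)]
        recursive_nat_fst recursive_nat_snd recursive_nat_id recursive_nat_const assms(2))
  ultimately show ?thesis by simp
qed

lemma recursive_nat_rev:
  "recursive_nat l \<Longrightarrow> recursive_nat (\<lambda>n. list_encode (rev (list_decode (l n))))"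
  using recursive_nat_rev_map[OF recursive_nat_id] by simp

lemma recursive_nat_map:
  assumes "recursive_nat f" "recursive_nat l"
  shows "recursive_nat (\<lambda>n. list_encode (map f (list_decode (l n))))"
  using recursive_nat_rev[OF recursive_nat_rev_map[OF assms]] by simp

section \<open>Prequential situations generated by a forecasting system\<close>

text \<open>The finite counterpart of pairing \<open>forecasts_along \<phi> \<omega>\<close> with
  \<open>\<omega>\<close>; the outcome paired with a forecast is not among those that it is based
  on.\<close>

definition prequential :: "forecasting_system \<Rightarrow> situation \<Rightarrow> prequential_situation" where
  "prequential \<phi> w = map (\<lambda>k. (\<phi> (take k w), w ! k)) [0..<length w]"

lemma prequential_Nil [simp]: "prequential \<phi> [] = []"
  by (simp add: prequential_def)

lemma prequential_snoc [simp]: "prequential \<phi> (w @ [x]) = prequential \<phi> w @ [(\<phi> w, x)]"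
  by (auto simp: prequential_def nth_append)

lemma map_snd_prequential [simp]: "map snd (prequential \<phi> w) = w"
  by (simp add: prequential_def comp_def map_nth)

lemma prequential_initial:
  "prequential \<phi> (initial \<omega> n) = initial (\<lambda>n. (forecasts_along \<phi> \<omega> n, \<omega> n)) n"
  by (auto simp: prequential_def initial_def forecasts_along_def take_map min_def)

text \<open>A forecast depends only on the outcomes already read, so one left-to-right fold that
  remembers them produces the whole sequence. Consing works at the front, hence the
  reversals.\<close>

lemma recursive_prequential:
  assumes "recursive_system \<phi>"
  obtains h where "recursive_nat h" "\<And>w. h (situation_code w) = prequential_code (prequential \<phi> w)"
proof -
  from assms obtain L H where LH: "recursive_nat L" "recursive_nat H"
    and L: "\<And>w. L (situation_code w) = rat_code (lo (\<phi> w))"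
    and H: "\<And>w. H (situation_code w) = rat_code (hi (\<phi> w))"
    unfolding recursive_system_def recursive_map_def by blast
  let ?rev = "\<lambda>c. list_encode (rev (list_decode c))"
  \<comment> \<open>The state pairs the reversed situation read so far with the reversed output.\<close>
  define f where "f s x = prod_encode (list_encode (x # list_decode (fst (prod_decode s))),
    list_encode (prod_encode (prod_encode (L (?rev (fst (prod_decode s))),
      H (?rev (fst (prod_decode s)))), x) # list_decode (snd (prod_decode s))))" for s x
  have f: "recursive_nat (\<lambda>p. f (fst (prod_decode p)) (snd (prod_decode p)))"
    unfolding f_def
    by (intro recursive_nat_pair recursive_nat_Cons recursive_nat_comp[OF LH(1)]
        recursive_nat_comp[OF LH(2)] recursive_nat_rev recursive_nat_fst recursive_nat_snd
        recursive_nat_id)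
  let ?e = "\<lambda>(I, x). prod_encode (forecast_code I, of_bool x)"
  have fold: "foldl f (prod_encode (0, 0)) (map of_bool w) =
      prod_encode (list_encode (rev (map of_bool w)), list_encode (rev (map ?e (prequential \<phi> w))))"
    for w
  proof (induction w rule: rev_induct)
    case (snoc x w)
    have "?rev (list_encode (rev (map of_bool w))) = situation_code w"
      by (simp add: situation_code_def)
    with snoc show ?case
      by (simp add: f_def L H forecast_code_def)
  qed simp
  define h where "h c = ?rev (snd (prod_decode (foldl f (prod_encode (0, 0)) (list_decode c))))" for c
  have "recursive_nat h"
    unfolding h_def
    by (intro recursive_nat_rev recursive_nat_snd recursive_nat_foldl f recursive_nat_const
        recursive_nat_id)
  moreover have "h (situation_code w) = prequential_code (prequential \<phi> w)" for w
    by (simp add: h_def situation_code_def prequential_code_def fold)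
  ultimately show ?thesis using that by blast
qed

lemma recursive_outcomes:
  obtains h where "recursive_nat h" "\<And>v. h (prequential_code v) = situation_code (map snd v)"
proof -
  have "list_encode (map (\<lambda>p. snd (prod_decode p)) (list_decode (prequential_code v)))
      = situation_code (map snd v)" for v
    by (simp add: prequential_code_def situation_code_def comp_def case_prod_unfold)
  with recursive_nat_map[OF recursive_nat_snd_prod_decode recursive_nat_id] show ?thesis
    using that by blast
qed

section \<open>Injectivity of the encodings\<close>

lemma rat_code_inject: "rat_code r = rat_code s \<longleftrightarrow> r = s"
proof -
  have "r = s" if "quotient_of r = quotient_of s"
    using that by (metis quotient_of_div prod.collapse)
  then show ?thesis
    unfolding rat_code_def prod_encode_eq
    by (metis (mono_tags, lifting) inj_int_encode injD prod.inj_map)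
qed

lemma forecast_code_inject: "forecast_code I = forecast_code J \<longleftrightarrow> I = J"
  unfolding forecast_code_def prod_encode_eq
  by (auto simp: rat_code_inject lo_def hi_def Rep_rat_forecast_inject[symmetric] prod_eq_iff)

text \<open>Turns comparison of codes, available through \<open>recursive_nat_if_eq\<close>, into a
  test for equality of prequential situations.\<close>

lemma prequential_code_inject: "prequential_code u = prequential_code v \<longleftrightarrow> u = v"
proof -
  have "inj (\<lambda>(I, x). prod_encode (forecast_code I, of_bool x))"
    by (auto simp: inj_def prod_encode_eq forecast_code_inject)
  then show ?thesis
    unfolding prequential_code_def list_encode_eq by (metis inj_map_eq_map)
qed

section \<open>Transfer of tests\<close>

text \<open>By \<open>prequential_snoc\<close>, the superfarthingale inequality at
  \<open>prequential \<phi> w\<close> for the forecast \<open>\<phi> w\<close> is the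
  supermartingale inequality at \<open>w\<close>.\<close>

lemma test_supermartingale_prequential:
  assumes "test_superfarthingale F"
  shows "test_supermartingale \<phi> (\<lambda>w. F (prequential \<phi> w))"
  using assms by (simp add: test_superfarthingale_def test_supermartingale_def)

lemma lower_semicomputable_prequential:
  assumes "lower_semicomputable prequential_code F" "recursive_system \<phi>"
  shows "lower_semicomputable situation_code (\<lambda>w. F (prequential \<phi> w))"
proof -
  from assms(1) obtain q g where q: "\<And>d n. q (d, n) \<le> q (d, Suc n)"
      "\<And>d. (\<lambda>m. real_of_rat (q (d, m))) \<longlonglongrightarrow> F d"
    and g: "recursive_nat g" "\<And>d n. g (prod_encode (prequential_code d, n)) = rat_code (q (d, n))"
    unfolding lower_semicomputable_def recursive_map_def by auto
  from recursive_prequential[OF assms(2)] obtain h where h: "recursive_nat h"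
    "\<And>w. h (situation_code w) = prequential_code (prequential \<phi> w)" by blast
  have "recursive_nat (\<lambda>c. g (prod_encode (h (fst (prod_decode c)), snd (prod_decode c))))"
    by (intro recursive_nat_comp[OF g(1)] recursive_nat_comp[OF h(1)] recursive_nat_pair
        recursive_nat_fst recursive_nat_snd recursive_nat_id)
  then have "recursive_map (\<lambda>(w, n). prod_encode (situation_code w, n)) rat_code
      (\<lambda>(w, n). q (prequential \<phi> w, n))"
    unfolding recursive_map_def by (intro exI conjI) (auto simp: g h)
  then show ?thesis
    unfolding lower_semicomputable_def using q
    by (intro exI[of _ "\<lambda>(w, n). q (prequential \<phi> w, n)"]) simp
qed

text \<open>By \<open>map_snd_prequential\<close> only \<open>map snd v\<close> can generate
  \<open>v\<close>, so a single equation decides whether \<open>v\<close> follows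
  \<open>\<phi>\<close>.\<close>

definition extension :: "forecasting_system \<Rightarrow> (situation \<Rightarrow> real) \<Rightarrow> prequential_situation \<Rightarrow> real" where
  "extension \<phi> T v = (if v = prequential \<phi> (map snd v) then T (map snd v) else 0)"

lemma extension_prequential [simp]: "extension \<phi> T (prequential \<phi> w) = T w"
  by (simp add: extension_def)

lemma upper_expectation_zero: "upper_expectation (forecast_set I) (\<lambda>x. 0) = 0"
  using upper_expectation_is_max[of I "\<lambda>x. 0"] by simp

lemma test_superfarthingale_extension:
  assumes "test_supermartingale \<phi> T"
  shows "test_superfarthingale (extension \<phi> T)"
proof -
  have "upper_expectation (forecast_set I) (\<lambda>x. extension \<phi> T (v @ [(I, x)])) \<le> extension \<phi> T v" for v I
  proof (cases "v = prequential \<phi> (map snd v) \<and> I = \<phi> (map snd v)")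
    case True
    then have "extension \<phi> T (v @ [(I, x)]) = T (map snd v @ [x])" for x
      by (simp add: extension_def)
    with True assms show ?thesis by (simp add: extension_def test_supermartingale_def)
  next
    case False
    \<comment> \<open>A successor follows \<open>\<phi>\<close> only if \<open>v\<close> does and
      \<open>I\<close> is the forecast after it. Otherwise both successors get 0, and the value at
      \<open>v\<close> is nonnegative.\<close>
    then have "extension \<phi> T (v @ [(I, x)]) = 0" for x by (auto simp: extension_def)
    with assms show ?thesis
      by (simp add: upper_expectation_zero extension_def test_supermartingale_def)
  qed
  with assms show ?thesis
    by (simp add: test_superfarthingale_def test_supermartingale_def extension_def)
qed

lemma lower_semicomputable_extension:
  assumes "lower_semicomputable situation_code T" "recursive_system \<phi>"
  shows "lower_semicomputable prequential_code (extension \<phi> T)"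
proof -
  from assms(1) obtain q g where q: "\<And>d n. q (d, n) \<le> q (d, Suc n)"
      "\<And>d. (\<lambda>m. real_of_rat (q (d, m))) \<longlonglongrightarrow> T d"
    and g: "recursive_nat g" "\<And>d n. g (prod_encode (situation_code d, n)) = rat_code (q (d, n))"
    unfolding lower_semicomputable_def recursive_map_def by auto
  from recursive_prequential[OF assms(2)] obtain h where h: "recursive_nat h"
    "\<And>w. h (situation_code w) = prequential_code (prequential \<phi> w)" by blast
  from recursive_outcomes obtain s where s: "recursive_nat s"
    "\<And>v. s (prequential_code v) = situation_code (map snd v)" by blast
  \<comment> \<open>Off the forecasts of \<open>\<phi>\<close> the constant approximation 0 is
    nondecreasing and has the limit that \<open>extension\<close> prescribes.\<close>
  define q' where "q' = (\<lambda>(v, n). if v = prequential \<phi> (map snd v) then q (map snd v, n) else 0)"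
  have "recursive_nat (\<lambda>c. if fst (prod_decode c) = h (s (fst (prod_decode c)))
      then g (prod_encode (s (fst (prod_decode c)), snd (prod_decode c))) else rat_code 0)"
    by (intro recursive_nat_if_eq recursive_nat_comp[OF g(1)] recursive_nat_comp[OF h(1)]
        recursive_nat_comp[OF s(1)] recursive_nat_pair recursive_nat_fst recursive_nat_snd
        recursive_nat_id recursive_nat_const)
  then have "recursive_map (\<lambda>(v, n). prod_encode (prequential_code v, n)) rat_code q'"
    unfolding recursive_map_def
    by (intro exI conjI) (auto simp: g h s prequential_code_inject q'_def)
  moreover have "(\<lambda>m. real_of_rat (q' (v, m))) \<longlonglongrightarrow> extension \<phi> T v" for v
    using q(2) by (simp add: q'_def extension_def)
  ultimately show ?thesis
    unfolding lower_semicomputable_def using q(1)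
    by (intro exI[of _ q']) (simp add: q'_def)
qed

text \<open>A forecast \<open>{1 - of_bool x}\<close> would have both endpoints 0 (for
  \<open>x\<close> true) or 1 (for \<open>x\<close> false), against \<open>hi > 0\<close> or
  \<open>lo < 1\<close>.\<close>

lemma nondegenerate_path_forecasts_along:
  assumes "nondegenerate_system \<phi>"
  shows "nondegenerate_path (\<lambda>n. (forecasts_along \<phi> \<omega> n, \<omega> n))"
proof -
  have "forecast_set (\<phi> w) \<noteq> {1 - of_bool x}" for w x
  proof
    assume eq: "forecast_set (\<phi> w) = {1 - of_bool x}"
    have "real_of_rat (lo (\<phi> w)) \<in> forecast_set (\<phi> w)" "real_of_rat (hi (\<phi> w)) \<in> forecast_set (\<phi> w)"
      using lo_hi(2) by (auto simp: forecast_set_def of_rat_less_eq)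
    then have "real_of_rat (lo (\<phi> w)) = 1 - of_bool x" "real_of_rat (hi (\<phi> w)) = 1 - of_bool x"
      unfolding eq by auto
    then show False
      using assms unfolding nondegenerate_system_def by (cases x) (auto dest: spec[of _ w])
  qed
  then show ?thesis by (simp add: nondegenerate_path_def forecasts_along_def)
qed

theorem theorem7:
  fixes \<phi> :: forecasting_system and \<omega> :: path
  assumes "nondegenerate_system \<phi>" and "recursive_system \<phi>"
  shows "martin_loef_random \<phi> \<omega> \<longleftrightarrow> game_random (\<lambda>n. (forecasts_along \<phi> \<omega> n, \<omega> n))"
proof
  assume ml: "martin_loef_random \<phi> \<omega>"
  have "limsup (\<lambda>n. ereal (F (initial (\<lambda>n. (forecasts_along \<phi> \<omega> n, \<omega> n)) n))) < \<infinity>"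
    if "test_superfarthingale F" "lower_semicomputable prequential_code F" for F
    using ml test_supermartingale_prequential[OF that(1)]
      lower_semicomputable_prequential[OF that(2) assms(2)]
    unfolding martin_loef_random_def prequential_initial[symmetric] by blast
  with nondegenerate_path_forecasts_along[OF assms(1)]
  show "game_random (\<lambda>n. (forecasts_along \<phi> \<omega> n, \<omega> n))"
    unfolding game_random_def by blast
next
  assume gr: "game_random (\<lambda>n. (forecasts_along \<phi> \<omega> n, \<omega> n))"
  \<comment> \<open>On prefixes of the prequential path \<open>extension \<phi> T\<close> takes the
    values of \<open>T\<close>, so boundedness transfers back.\<close>
  have "limsup (\<lambda>n. ereal (T (initial \<omega> n))) < \<infinity>"
    if "test_supermartingale \<phi> T" "lower_semicomputable situation_code T" for T
    using gr test_superfarthingale_extension[OF that(1)]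
      lower_semicomputable_extension[OF that(2) assms(2)]
    unfolding game_random_def prequential_initial[symmetric] by fastforce
  then show "martin_loef_random \<phi> \<omega>"
    unfolding martin_loef_random_def by blast
qed

end
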